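(* Let $A\in\mathbb{R}^{n\times n}$, $B\in\mathbb{R}^{n\times m}$ with $(A,B)$ controllable, $Q\in\mathbb{R}^{n\times n}$ symmetric positive semidefinite with $(A,Q^{1/2})$ observable, $R\in\mathbb{R}^{m\times m}$ symmetric positive definite, and let $P^*$ be the unique symmetric positive definite solution of $A^TP+PA-PBR^{-1}B^TP+Q=0$. For symmetric $P$ let $\mathcal{A}(P)=A-BR^{-1}B^TP$. Consider the robust policy iteration: given a symmetric $\tilde P_0\in\mathbb{R}^{n\times n}$, set $\hat K_1=R^{-1}B^T\tilde P_0$ and $\Delta G_0=0$; given a sequence $(\Delta G_i)_{i\ge1}$ of symmetric $(n+m)\times(n+m)$ matrices, for $i=1,2,\dots$, as long as $\hat K_i$ is stabilizing (i.e. $A-B\hat K_i$ is Hurwitz), let $\tilde P_i$ be the unique symmetric solution of $$(A-B\hat K_i)^T\tilde P_i+\tilde P_i(A-B\hat K_i)+Q+\hat K_i^TR\hat K_i=0,$$ let $$\tilde G_i=\begin{bmatrix} Q+A^T\tilde P_i+\tilde P_iA & \tilde P_iB\\ B^T\tilde P_i & R\end{bmatrix},\qquad \hat G_i=\tilde G_i+\Delta G_i,$$ and, when the lower-right $m\times m$ block $\hat G_{i,22}$ of $\hat G_i$ is invertible, set $\hat K_{i+1}=\hat G_{i,22}^{-1}\hat G_{i,21}$, where $\hat G_{i,21}$ is the lower-left $m\times n$ block of $\hat G_i$. Write $\|\Delta G\|_\infty=\sup_{i\ge 0}\|\Delta G_i\|_F$. Then for every $\sigma\in(0,1)$ there exists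 $\delta_0>0$ such that (a) for every symmetric $P$ with $\|P-P^*\|_F<\delta_0$, $\mathcal{A}(P)$ is Hurwitz and the symmetric solution $P^+$ of $\mathcal{A}(P)^TP^++P^+\mathcal{A}(P)=-Q-PBR^{-1}B^TP$ satisfies $\|P^+-P^*\|_F\le\sigma\|P-P^*\|_F$, and (b) there exist constants $\delta_1>0$ and $c_3>0$ (depending on $\delta_0$) such that, whenever $\|\tilde P_0-P^*\|_F<\delta_0$ and $\|\Delta G\|_\infty<\delta_1$: (i) $\hat G_{i,22}$ is invertible and $\hat K_i$ is stabilizing for all integers $i\ge1$ (so the iteration is well defined for all $i$); (ii) for all integers $i\ge0$, $$\|\tilde P_i-P^*\|_F\le \sigma^i\|\tilde P_0-P^*\|_F+\frac{c_3}{1-\sigma}\|\Delta G\|_\infty;$$ (iii) if $\lim_{i\to\infty}\|\Delta G_i\|_F=0$, then $\lim_{i\to\infty}\|\tilde P_i-P^*\|_F=0$.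
   Context: $\|\cdot\|_F$ denotes the Frobenius norm; a square matrix is Hurwitz if all its eigenvalues have negative real part; a gain $K\in\mathbb{R}^{m\times n}$ is stabilizing if $A-BK$ is Hurwitz. $\Delta G_i$ models errors in the policy evaluation step of Kleinman's policy iteration for the LQR problem of minimizing $\int_0^\infty x^TQx+u^TRu\,dt$ subject to $\dot x=Ax+Bu$. The conclusion (ii) is a local input-to-state stability property of the iteration with $\Delta G$ as input. *)

theory Defs
  imports "HOL-Analysis.Analysis"
begin

text \<open>Matrices are HOL-Analysis Cartesian matrices; real^'c^'r has 'r rows and 'c columns.
  The library norm on such a matrix is the square root of the sum of squares of all entries,
  i.e. the Frobenius norm.\<close>

definition mpow :: "real^'n^'n \<Rightarrow> nat \<Rightarrow> real^'n^'n" where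
  "mpow A k = (((**) A) ^^ k) (mat 1)"

definition symm :: "real^'n^'n \<Rightarrow> bool" where
  "symm P \<longleftrightarrow> transpose P = P"

definition psd :: "real^'n^'n \<Rightarrow> bool" where
  "psd P \<longleftrightarrow> symm P \<and> (\<forall>x. 0 \<le> x \<bullet> (P *v x))"

definition pd :: "real^'n^'n \<Rightarrow> bool" where
  "pd P \<longleftrightarrow> symm P \<and> (\<forall>x. x \<noteq> 0 \<longrightarrow> 0 < x \<bullet> (P *v x))"

text \<open>Principal (symmetric PSD) square root.\<close>
definition msqrt :: "real^'n^'n \<Rightarrow> real^'n^'n" where
  "msqrt Q = (THE S. psd S \<and> S ** S = Q)"

text \<open>Kalman rank conditions: rank [B, AB, ..., A^(n-1) B] = n and
  rank [C; CA; ...; C A^(n-1)] = n (rank = dimension of the span of the columns/rows).\<close>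
definition controllable :: "real^'n^'n \<Rightarrow> real^'m^'n \<Rightarrow> bool" where
  "controllable A B \<longleftrightarrow>
     dim (span (\<Union>k<CARD('n). columns (mpow A k ** B))) = CARD('n)"

definition observable :: "real^'n^'n \<Rightarrow> real^'n^'p \<Rightarrow> bool" where
  "observable A C \<longleftrightarrow>
     dim (span (\<Union>k<CARD('n). rows (C ** mpow A k))) = CARD('n)"

text \<open>Eigenvalues of a real matrix are taken over the complex numbers.\<close>
definition cmat :: "real^'n^'m \<Rightarrow> complex^'n^'m" where
  "cmat A = (\<chi> i j. complex_of_real (A $ i $ j))"

definition hurwitz :: "real^'n^'n \<Rightarrow> bool" where
  "hurwitz A \<longleftrightarrow> (\<forall>e::complex. (\<exists>v::complex^'n. v \<noteq> 0 \<and> cmat A *v v = e *s v) \<longrightarrow> Re e < 0)"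

definition stabilizing :: "real^'n^'n \<Rightarrow> real^'m^'n \<Rightarrow> real^'n^'m \<Rightarrow> bool" where
  "stabilizing A B K \<longleftrightarrow> hurwitz (A - B ** K)"

text \<open>Closed-loop matrix \<A>(P) = A - B R^-1 B^T P.\<close>
definition Acl :: "real^'n^'n \<Rightarrow> real^'m^'n \<Rightarrow> real^'m^'m \<Rightarrow> real^'n^'n \<Rightarrow> real^'n^'n" where
  "Acl A B R P = A - B ** matrix_inv R ** transpose B ** P"

text \<open>Policy evaluation: the unique symmetric solution of the Lyapunov equation for gain K.\<close>
definition lyap_sol :: "real^'n^'n \<Rightarrow> real^'m^'n \<Rightarrow> real^'n^'n \<Rightarrow> real^'m^'m \<Rightarrow> real^'n^'m \<Rightarrow> real^'n^'n" where
  "lyap_sol A B Q R K = (THE P. symm P \<and>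
      transpose (A - B ** K) ** P + P ** (A - B ** K) + Q + transpose K ** R ** K = 0)"

text \<open>The matrix G~ built from P, indexed by ('n + 'm): Inl = first n coordinates, Inr = last m.\<close>
definition Gtil :: "real^'n^'n \<Rightarrow> real^'m^'n \<Rightarrow> real^'n^'n \<Rightarrow> real^'m^'m \<Rightarrow> real^'n^'n
                    \<Rightarrow> real^('n + 'm)^('n + 'm)" where
  "Gtil A B Q R P = (\<chi> i j. case (i, j) of
       (Inl a, Inl b) \<Rightarrow> (Q + transpose A ** P + P ** A) $ a $ b
     | (Inl a, Inr b) \<Rightarrow> (P ** B) $ a $ b
     | (Inr a, Inl b) \<Rightarrow> (transpose B ** P) $ a $ b
     | (Inr a, Inr b) \<Rightarrow> R $ a $ b)"

definition blk22 :: "real^('n::finite + 'm::finite)^('n + 'm) \<Rightarrow> real^'m^'m" where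
  "blk22 G = (\<chi> a b. G $ Inr a $ Inr b)"

definition blk21 :: "real^('n::finite + 'm::finite)^('n + 'm) \<Rightarrow> real^'n^'m" where
  "blk21 G = (\<chi> a b. G $ Inr a $ Inl b)"

text \<open>Robust policy iteration. Khat (Suc 0) = R^-1 B^T P0, and for i >= 1
  Khat (i+1) = Ghat_{i,22}^-1 Ghat_{i,21} with Ghat_i = G~(P~_i) + dG i,
  P~_i = lyap_sol (Khat i). Khat 0 is unused.\<close>
fun Khat :: "real^'n^'n \<Rightarrow> real^'m^'n \<Rightarrow> real^'n^'n \<Rightarrow> real^'m^'m \<Rightarrow> real^'n^'n
             \<Rightarrow> (nat \<Rightarrow> real^('n + 'm)^('n + 'm)) \<Rightarrow> nat \<Rightarrow> real^'n^'m" where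
  "Khat A B Q R P0 dG 0 = matrix_inv R ** transpose B ** P0"
| "Khat A B Q R P0 dG (Suc 0) = matrix_inv R ** transpose B ** P0"
| "Khat A B Q R P0 dG (Suc (Suc i)) =
     (let G = Gtil A B Q R (lyap_sol A B Q R (Khat A B Q R P0 dG (Suc i))) + dG (Suc i)
      in matrix_inv (blk22 G) ** blk21 G)"

definition Ptil :: "real^'n^'n \<Rightarrow> real^'m^'n \<Rightarrow> real^'n^'n \<Rightarrow> real^'m^'m \<Rightarrow> real^'n^'n
             \<Rightarrow> (nat \<Rightarrow> real^('n + 'm)^('n + 'm)) \<Rightarrow> nat \<Rightarrow> real^'n^'n" where
  "Ptil A B Q R P0 dG i = (if i = 0 then P0 else lyap_sol A B Q R (Khat A B Q R P0 dG i))"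

definition Ghat :: "real^'n^'n \<Rightarrow> real^'m^'n \<Rightarrow> real^'n^'n \<Rightarrow> real^'m^'m \<Rightarrow> real^'n^'n
             \<Rightarrow> (nat \<Rightarrow> real^('n + 'm)^('n + 'm)) \<Rightarrow> nat \<Rightarrow> real^('n + 'm)^('n + 'm)" where
  "Ghat A B Q R P0 dG i = Gtil A B Q R (Ptil A B Q R P0 dG i) + dG i"

end

(*
  Write Ps for the Riccati solution and Ks = R^-1 B^T Ps for its gain.  Completing the square shows
  that the value matrix P of a stabilizing gain K satisfies L (P - Ps) = - (K - Ks)^T R (K - Ks),
  where L X = M^T X + X M with M = A - B K.  At K = Ks observability makes L injective on symmetric
  matrices (by an extremal eigenvector argument relative to Ps, which avoids matrix exponentials),
  hence |L X| >= c |X|, and this bound persists for K near Ks.  So policy evaluation squares the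
  gain error, while policy improvement turns an error e in P and a perturbation of size d into a
  gain error of at most beta e + gamma d.  Near Ps the composition satisfies
  e' <= sigma e + c d, and the claims are properties of this scalar recursion.
*)
theory Submission
  imports Defs
begin

section \<open>Matrix algebra and the Frobenius norm\<close>

lemma norm_matrix_vector_mult_le:
  fixes M :: "real^'n^'m"
  shows "norm (M *v x) \<le> norm M * norm x"
proof -
  have "norm ((M *v x) $ i) \<le> norm (M $ i) * norm x" for i
    by (simp add: matrix_vector_mul_component Cauchy_Schwarz_ineq2)
  then have "L2_set (\<lambda>i. norm ((M *v x) $ i)) UNIV \<le> L2_set (\<lambda>i. norm (M $ i) * norm x) UNIV"
    by (intro L2_set_mono) auto
  also have "\<dots> = L2_set (\<lambda>i. norm (M $ i)) UNIV * norm x"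
    by (simp add: L2_set_left_distrib)
  finally show ?thesis by (simp add: norm_vec_def)
qed

lemma norm_transpose:
  fixes M :: "real^'n^'m"
  shows "norm (transpose M) = norm M"
  by (simp add: norm_vec_def L2_set_def transpose_def sum_nonneg) (rule sum.swap)

lemma norm_matrix_mult_le:
  fixes M :: "real^'n^'m" and N :: "real^'k^'n"
  shows "norm (M ** N) \<le> norm M * norm N"
proof -
  have row: "(M ** N) $ i = transpose N *v (M $ i)" for i
    by (simp add: vec_eq_iff matrix_matrix_mult_def vector_matrix_mult_def mult.commute)
  have "norm ((M ** N) $ i) \<le> norm (M $ i) * norm N" for i
    unfolding row using norm_matrix_vector_mult_le[of "transpose N" "M $ i"]
    by (simp add: norm_transpose mult.commute)
  then have "L2_set (\<lambda>i. norm ((M ** N) $ i)) UNIV \<le> L2_set (\<lambda>i. norm (M $ i) * norm N) UNIV"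
    by (intro L2_set_mono) auto
  also have "\<dots> = L2_set (\<lambda>i. norm (M $ i)) UNIV * norm N"
    by (simp add: L2_set_left_distrib)
  finally show ?thesis by (simp add: norm_vec_def)
qed

text \<open>Submultiplicativity of the Frobenius norm is boundedness with constant 1; the
  interpretation yields the distributivity rules collected in \<open>mat_simps\<close>.\<close>

interpretation mmult: bounded_bilinear "(**) :: real^'n^'m \<Rightarrow> real^'k^'n \<Rightarrow> real^'k^'m"
proof
  show "\<exists>K. \<forall>a b. norm ((a :: real^'n^'m) ** (b :: real^'k^'n)) \<le> norm a * norm b * K"
    by (rule exI[of _ 1]) (simp add: norm_matrix_mult_le)
qed (simp_all add: vec_eq_iff matrix_matrix_mult_def algebra_simps sum.distrib sum_distrib_left)

interpretation mvmult: bounded_bilinear "(*v) :: real^'n^'m \<Rightarrow> real^'n \<Rightarrow> real^'m"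
proof
  show "\<exists>K. \<forall>a b. norm ((a :: real^'n^'m) *v b) \<le> norm a * norm b * K"
    by (rule exI[of _ 1]) (simp add: norm_matrix_vector_mult_le)
qed (simp_all add: vec_eq_iff matrix_vector_mult_def algebra_simps sum.distrib sum_distrib_left)

lemma transpose_add: "transpose (M + N) = transpose M + transpose N"
  and transpose_diff: "transpose (U - V) = transpose U - transpose V"
  and transpose_minus: "transpose (- V) = - transpose V"
  and transpose_zero: "transpose 0 = 0"
  by (simp_all add: vec_eq_iff transpose_def)

lemmas mat_simps = mmult.add_left mmult.add_right mmult.diff_left mmult.diff_right
  mmult.minus_left mmult.minus_right mmult.scaleR_left mmult.scaleR_right
  mvmult.add_left mvmult.add_right mvmult.diff_left mvmult.diff_right
  mvmult.minus_left mvmult.minus_right mvmult.scaleR_left mvmult.scaleR_right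
  transpose_add transpose_diff transpose_minus transpose_zero transpose_scalar

lemma inner_matrix_transpose:
  fixes M :: "real^'n^'m"
  shows "x \<bullet> (M *v y) = (transpose M *v x) \<bullet> y"
  by (simp add: dot_lmul_matrix)

lemma symm_inner: "symm M \<Longrightarrow> x \<bullet> (M *v y) = (M *v x) \<bullet> y"
  unfolding symm_def by (metis inner_matrix_transpose)

lemma symm_0: "symm 0"
  by (simp add: symm_def mat_simps)

lemma subspace_symm: "subspace {M :: real^'n^'n. symm M}"
  by (auto simp: subspace_def symm_def mat_simps)

lemma symm_add: "symm M \<Longrightarrow> symm N \<Longrightarrow> symm (M + N)"
  and symm_diff: "symm M \<Longrightarrow> symm N \<Longrightarrow> symm (M - N)"
  and symm_minus: "symm M \<Longrightarrow> symm (- M)"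
  and symm_scaleR: "symm M \<Longrightarrow> symm (c *\<^sub>R M)"
  by (simp_all add: symm_def mat_simps)

lemma symm_congruence: "symm M \<Longrightarrow> symm (transpose K ** M ** K)"
  by (simp add: symm_def matrix_transpose_mul matrix_mul_assoc)

section \<open>Semidefinite matrices and square roots\<close>

lemma pd_imp_psd: "pd M \<Longrightarrow> psd M"
  unfolding pd_def psd_def by (metis inner_zero_left order_le_less)

lemma psd_add: "psd M \<Longrightarrow> psd N \<Longrightarrow> psd (M + N)"
  by (simp add: psd_def symm_add mat_simps inner_add_right)

lemma psd_congruence: "psd M \<Longrightarrow> psd (transpose K ** M ** K)"
  by (simp add: psd_def symm_congruence inner_matrix_transpose[of _ "transpose K"]
      flip: matrix_vector_mul_assoc del: transpose_matrix_vector)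

text \<open>Along the ray \<open>x - t M x\<close> the form equals
  \<open>t (t q - 2 |M x|^2)\<close>, with \<open>q\<close> its value at \<open>M x\<close>. Unless
  \<open>M x = 0\<close>, this is negative for small \<open>t > 0\<close>.\<close>

lemma psd_kernel:
  assumes M: "psd M" and x: "x \<bullet> (M *v x) = 0"
  shows "M *v x = 0"
proof (rule ccontr)
  let ?y = "M *v x"
  assume "?y \<noteq> 0"
  then have a: "?y \<bullet> ?y > 0" by simp
  define q where "q = ?y \<bullet> (M *v ?y)"
  have q: "q \<ge> 0" using M by (simp add: psd_def q_def)
  have sym: "x \<bullet> (M *v ?y) = ?y \<bullet> ?y" using M by (simp add: psd_def symm_inner)
  \<comment> \<open>The \<open>+ 1\<close> covers \<open>q = 0\<close>; the choice yields
    \<open>t q \<le> |M x|^2\<close>, against the bound \<open>2 |M x|^2 \<le> t q\<close> forced by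
    semidefiniteness.\<close>
  define t where "t = (?y \<bullet> ?y) / (q + 1)"
  have t: "t > 0" using a q by (simp add: t_def)
  have "0 \<le> (x - t *\<^sub>R ?y) \<bullet> (M *v (x - t *\<^sub>R ?y))" using M by (simp add: psd_def)
  also have "\<dots> = t * (t * q - 2 * (?y \<bullet> ?y))"
    using x sym by (simp add: mat_simps inner_diff_left inner_diff_right q_def algebra_simps)
  finally have "2 * (?y \<bullet> ?y) \<le> t * q" using t by (simp add: zero_le_mult_iff)
  moreover have "t * q \<le> ?y \<bullet> ?y"
    using q a by (simp add: t_def field_simps mult_left_le)
  ultimately show False using a by simp
qed

lemma psd_antisym:
  assumes "psd M" and "psd (- M)"
  shows "M = 0"
proof -
  have "M *v x = 0" for x
  proof (rule psd_kernel[OF assms(1)])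
    show "x \<bullet> (M *v x) = 0"
      using assms by (auto simp: psd_def mat_simps intro: antisym)
  qed
  then show ?thesis by (simp add: matrix_eq)
qed

text \<open>The number \<open>\<mu>\<close> is the largest eigenvalue of the pencil \<open>X - \<mu> P\<close>, i.e. the maximum of the
  generalised Rayleigh quotient \<open>x\<^sup>T X x / x\<^sup>T P x\<close>.\<close>
lemma pencil_max_eigenvalue:
  fixes P X :: "real^'n^'n"
  assumes P: "pd P" and X: "symm X"
  obtains \<mu> x where "x \<noteq> 0" "psd (\<mu> *\<^sub>R P - X)" "(\<mu> *\<^sub>R P - X) *v x = 0"
proof -
  define f where "f = (\<lambda>x::real^'n. (x \<bullet> (X *v x)) / (x \<bullet> (P *v x)))"
  have pos: "0 < x \<bullet> (P *v x)" if "x \<noteq> 0" for x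
    using P that by (simp add: pd_def)
  have "continuous_on (sphere 0 1) f"
    unfolding f_def
    by (intro continuous_intros linear_continuous_on matrix_vector_mul_bounded_linear)
       (metis norm_zero pos less_irrefl mem_sphere_0 zero_neq_one)
  moreover have "sphere (0::real^'n) 1 \<noteq> {}" by simp
  ultimately obtain x where x: "x \<in> sphere 0 1" and max: "\<And>y. y \<in> sphere 0 1 \<Longrightarrow> f y \<le> f x"
    using continuous_attains_sup[of "sphere (0::real^'n) 1" f] by auto
  let ?M = "f x *\<^sub>R P - X"
  have x0: "x \<noteq> 0" using x by auto
  have "0 \<le> y \<bullet> (?M *v y)" for y
  proof (cases "y = 0")
    case False
    \<comment> \<open>The quotient is invariant under scaling, so the maximum over the unit sphere
      is a global one.\<close>
    have "f y = f (y /\<^sub>R norm y)"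
      using False by (simp add: f_def mat_simps)
    also have "\<dots> \<le> f x" by (rule max) (use False in simp)
    finally have "y \<bullet> (X *v y) \<le> f x * (y \<bullet> (P *v y))"
      using pos[OF False] by (simp add: f_def[of] divide_le_eq)
    then show ?thesis by (simp add: mat_simps inner_diff_right)
  qed simp
  then have psd: "psd ?M"
    using P X by (simp add: psd_def pd_def symm_diff symm_scaleR)
  moreover have "x \<bullet> (?M *v x) = 0"
    using pos[OF x0] by (simp add: mat_simps inner_diff_right f_def)
  ultimately show thesis using that x0 psd_kernel by blast
qed

section \<open>Existence and uniqueness of the positive semidefinite square root\<close>

lemma pd_mat_1: "pd (mat 1)"
  by (simp add: pd_def symm_def)

text \<open>For a unit vector this is the orthogonal projection onto its line, the matrix used for
  deflation below.\<close>

definition outer :: "real^'n \<Rightarrow> real^'n^'n" where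
  "outer x = (\<chi> i j. x $ i * x $ j)"

lemma outer_vector: "outer x *v y = (x \<bullet> y) *\<^sub>R x"
  by (simp add: outer_def vec_eq_iff matrix_vector_mult_def inner_vec_def sum_distrib_left
      sum_distrib_right mult_ac)

lemma symm_outer: "symm (outer x)"
  by (simp add: symm_def outer_def transpose_def mult.commute)

text \<open>Deflation: subtracting the top eigenvalue times the projection onto its unit eigenvector
  \<open>u\<close> preserves semidefiniteness and adds \<open>u\<close> to the kernel, so induction
  on the rank applies. A root of the deflated matrix is completed by \<open>sqrt \<mu>\<close> times
  that projection.\<close>

lemma psd_sqrt_exists:
  fixes Q :: "real^'n^'n"
  assumes "psd Q"
  shows "\<exists>S. psd S \<and> S ** S = Q"
  using assms
\<comment> \<open>By rank-nullity the measure is the rank of \<open>Q\<close>.\<close>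
proof (induction "CARD('n) - dim {x. Q *v x = 0}" arbitrary: Q rule: less_induct)
  case less
  have Q: "psd Q" "symm Q" using less.prems by (auto simp: psd_def)
  show ?case
  proof (cases "Q = 0")
    case True
    then show ?thesis by (intro exI[of _ 0]) (simp add: psd_def symm_0)
  next
    case False
    obtain \<mu> x where x0: "x \<noteq> 0" and M: "psd (\<mu> *\<^sub>R mat 1 - Q)" "(\<mu> *\<^sub>R mat 1 - Q) *v x = 0"
      using pencil_max_eigenvalue[OF pd_mat_1 Q(2)] by blast
    have \<mu>: "\<mu> > 0"
    proof (rule ccontr)
      assume "\<not> \<mu> > 0"
      have "y \<bullet> (Q *v y) \<le> 0" for y
      proof -
        have "y \<bullet> (Q *v y) \<le> \<mu> * (y \<bullet> y)"
          using M(1) by (simp add: psd_def mat_simps inner_diff_right)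
        also have "\<dots> \<le> 0" using \<open>\<not> \<mu> > 0\<close> by (simp add: mult_nonpos_nonneg)
        finally show ?thesis .
      qed
      then have "psd (- Q)" using Q(2) by (simp add: psd_def symm_minus mat_simps)
      then show False using False psd_antisym Q(1) by blast
    qed
    define u where "u = x /\<^sub>R norm x"
    have u: "u \<bullet> u = 1" using x0 by (subst norm_eq_1[symmetric]) (simp add: u_def)
    have Qu: "Q *v u = \<mu> *\<^sub>R u" using M(2) by (simp add: u_def mat_simps) (metis mult.commute scaleR_scaleR)
    define Q' where "Q' = Q - \<mu> *\<^sub>R outer u"
    have Q'v: "Q' *v y = Q *v y - (\<mu> * (u \<bullet> y)) *\<^sub>R u" for y
      by (simp add: Q'_def mat_simps outer_vector)
    have Q'u: "Q' *v u = 0" by (simp add: Q'v Qu u)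
    have sQ': "symm Q'"
      by (simp add: Q'_def Q(2) symm_diff symm_scaleR symm_outer)
    have "0 \<le> y \<bullet> (Q' *v y)" for y
    proof -
      \<comment> \<open>On the component \<open>z\<close> of \<open>y\<close> orthogonal to
        \<open>u\<close> the matrices \<open>Q'\<close> and \<open>Q\<close> agree, while
        \<open>Q'\<close> annihilates the rest.\<close>
      define z where "z = y - (u \<bullet> y) *\<^sub>R u"
      have "u \<bullet> z = 0" by (simp add: z_def inner_diff_right u)
      then have Q'z: "Q' *v z = Q *v z" by (simp add: Q'v)
      have y: "y = z + (u \<bullet> y) *\<^sub>R u" by (simp add: z_def)
      have "Q' *v y = Q' *v z" by (subst y) (simp add: mat_simps Q'u)
      then have "y \<bullet> (Q' *v y) = z \<bullet> (Q *v z) + (u \<bullet> y) * (u \<bullet> (Q' *v z))"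
        using Q'z by (subst y) (simp add: inner_add_left)
      also have "u \<bullet> (Q' *v z) = 0" using symm_inner[OF sQ'] Q'u by simp
      finally show ?thesis using Q(1) by (simp add: psd_def)
    qed
    with sQ' have psdQ': "psd Q'" by (simp add: psd_def)
    have ker: "subspace {x. N *v x = 0}" for N :: "real^'n^'n"
      by (auto simp: subspace_def mat_simps)
    have sub: "{x. Q *v x = 0} \<subseteq> {x. Q' *v x = 0}"
    proof clarify
      fix y assume y: "Q *v y = 0"
      \<comment> \<open>Kernel vectors of \<open>Q\<close> are orthogonal to \<open>u\<close>, whose
        eigenvalue is nonzero, so deflation does not affect them.\<close>
      have "\<mu> * (u \<bullet> y) = u \<bullet> (Q *v y)" by (simp add: symm_inner Q(2) Qu)
      then show "Q' *v y = 0" by (simp add: Q'v y)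
    qed
    have "dim {x. Q *v x = 0} \<noteq> dim {x. Q' *v x = 0}"
    proof
      assume "dim {x. Q *v x = 0} = dim {x. Q' *v x = 0}"
      then have "{x. Q *v x = 0} = {x. Q' *v x = 0}"
        using subspace_dim_equal[OF ker ker sub] by simp
      with Q'u have "Q *v u = 0" by blast
      then show False using Qu \<mu> u by auto
    qed
    moreover have "dim {x. Q *v x = 0} \<le> dim {x. Q' *v x = 0}"
      by (rule dim_subset[OF sub])
    moreover have "dim {x. Q' *v x = 0} \<le> CARD('n)"
      by (rule dim_subset_UNIV_cart)
    ultimately obtain S where S: "psd S" "S ** S = Q'"
      using less.hyps[OF _ psdQ'] by force
    have sS: "symm S" using S by (simp add: psd_def)
    \<comment> \<open>That \<open>S\<close> annihilates \<open>u\<close> makes the cross terms of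
      \<open>T ** T\<close> vanish.\<close>
    have "(S *v u) \<bullet> (S *v u) = u \<bullet> (Q' *v u)"
      using sS by (simp add: symm_inner flip: S(2) matrix_vector_mul_assoc)
    then have Su: "S *v u = 0" by (simp add: Q'u)
    define T where "T = S + sqrt \<mu> *\<^sub>R outer u"
    have Tv: "T *v y = S *v y + (sqrt \<mu> * (u \<bullet> y)) *\<^sub>R u" for y
      by (simp add: T_def mat_simps outer_vector)
    have "T *v (T *v y) = Q *v y" for y
    proof -
      have "u \<bullet> (S *v y) = 0" using symm_inner[OF sS] Su by simp
      then have "u \<bullet> (T *v y) = sqrt \<mu> * (u \<bullet> y)" by (simp add: Tv inner_add_right u)
      moreover have "S *v (T *v y) = S *v (S *v y)" by (simp add: Tv mat_simps Su)
      moreover have "S *v (S *v y) = Q' *v y" by (simp add: matrix_vector_mul_assoc S(2))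
      moreover have "sqrt \<mu> * (sqrt \<mu> * (u \<bullet> y)) = \<mu> * (u \<bullet> y)"
        using \<mu> by (simp flip: mult.assoc)
      ultimately have "T *v (T *v y) = Q' *v y + (\<mu> * (u \<bullet> y)) *\<^sub>R u"
        by (simp only: Tv[of "T *v y"])
      then show ?thesis by (simp add: Q'v)
    qed
    then have "T ** T = Q" by (simp add: matrix_eq flip: matrix_vector_mul_assoc)
    moreover have "psd T"
      using S(1) sS \<mu> by (auto simp: psd_def T_def symm_add symm_scaleR symm_outer mat_simps
          outer_vector inner_add_right inner_commute mult_ac intro!: add_nonneg_nonneg)
    ultimately show ?thesis by blast
  qed
qed

text \<open>Otherwise \<open>D = S - T\<close> has an eigenvector \<open>x\<close> with positive eigenvalue, and
  \<open>D (S + T) + (S + T) D = 2 (S\<^sup>2 - T\<^sup>2) = 0\<close> forces \<open>x\<^sup>T (S + T) x = 0\<close>.\<close>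
lemma psd_sqrt_le:
  assumes S: "psd S" and T: "psd T" and eq: "S ** S = T ** T"
  shows "psd (T - S)"
proof -
  have sym: "symm S" "symm T" using S T by (auto simp: psd_def)
  obtain \<mu> x where x: "x \<noteq> 0" "psd (\<mu> *\<^sub>R mat 1 - (S - T))" "(\<mu> *\<^sub>R mat 1 - (S - T)) *v x = 0"
    using pencil_max_eigenvalue[OF pd_mat_1 symm_diff[OF sym]] by blast
  have Dx: "S *v x = \<mu> *\<^sub>R x + T *v x" using x(3) by (simp add: mat_simps algebra_simps)
  have "\<mu> \<le> 0"
  proof (rule ccontr)
    assume \<mu>: "\<not> \<mu> \<le> 0"
    have "x \<bullet> (S *v (S *v x)) = x \<bullet> (T *v (T *v x))"
      by (simp add: matrix_vector_mul_assoc eq)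
    then have "(S *v x) \<bullet> (S *v x) = (T *v x) \<bullet> (T *v x)"
      by (simp add: symm_inner sym)
    also have "T *v x = S *v x - \<mu> *\<^sub>R x" by (simp add: Dx)
    finally have "\<mu> * (2 * (x \<bullet> (S *v x)) - \<mu> * (x \<bullet> x)) = 0"
      by (simp add: inner_diff_left inner_diff_right inner_commute algebra_simps)
    moreover have "x \<bullet> (S *v x) = \<mu> * (x \<bullet> x) + x \<bullet> (T *v x)"
      by (simp add: Dx inner_add_right)
    ultimately have "\<mu> * (x \<bullet> x) + 2 * (x \<bullet> (T *v x)) = 0" using \<mu> by auto
    moreover have "\<mu> * (x \<bullet> x) > 0" "x \<bullet> (T *v x) \<ge> 0"
      using \<mu> x(1) T by (auto simp: psd_def)
    ultimately show False by linarith
  qed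
  have "0 \<le> y \<bullet> ((T - S) *v y)" for y
  proof -
    have "0 \<le> y \<bullet> ((\<mu> *\<^sub>R mat 1 - (S - T)) *v y)" using x(2) by (simp add: psd_def)
    moreover have "\<mu> * (y \<bullet> y) \<le> 0" using \<open>\<mu> \<le> 0\<close> by (simp add: mult_nonpos_nonneg)
    ultimately show ?thesis by (simp add: mat_simps inner_diff_right)
  qed
  then show ?thesis using sym by (simp add: psd_def symm_diff)
qed

lemma psd_sqrt_unique:
  assumes "psd S" and "psd T" and "S ** S = T ** T"
  shows "S = T"
proof -
  have "psd (T - S)" "psd (- (T - S))"
    using psd_sqrt_le[OF assms] psd_sqrt_le[OF assms(2,1) assms(3)[symmetric]] by simp_all
  then show ?thesis using psd_antisym by fastforce
qed

lemma msqrt: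
  assumes "psd Q"
  shows "psd (msqrt Q)" and "msqrt Q ** msqrt Q = Q"
proof -
  have "\<exists>!S. psd S \<and> S ** S = Q"
    using psd_sqrt_exists[OF assms] psd_sqrt_unique by metis
  then have "psd (msqrt Q) \<and> msqrt Q ** msqrt Q = Q"
    unfolding msqrt_def by (rule theI')
  then show "psd (msqrt Q)" and "msqrt Q ** msqrt Q = Q" by auto
qed

text \<open>With \<open>S\<close> the root, \<open>|S x|^2 = x^T Q x\<close>. Observability is
  stated through \<open>msqrt Q\<close>, whereas the Lyapunov argument controls the kernel of
  \<open>Q\<close>.\<close>

lemma msqrt_kernel:
  assumes "psd Q" and "Q *v x = 0"
  shows "msqrt Q *v x = 0"
proof -
  have "(msqrt Q *v x) \<bullet> (msqrt Q *v x) = x \<bullet> (Q *v x)"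
    using msqrt[OF assms(1)] by (metis matrix_vector_mul_assoc psd_def symm_inner)
  then show ?thesis by (simp add: assms)
qed

section \<open>The Lyapunov operator\<close>

text \<open>The matrix of the time derivative of the form \<open>x^T X x\<close> along
  \<open>x' = M x\<close>.\<close>

definition lyap :: "real^'n^'n \<Rightarrow> real^'n^'n \<Rightarrow> real^'n^'n" where
  "lyap M X = transpose M ** X + X ** M"

lemma linear_lyap: "linear (lyap M)"
  by (rule linearI) (simp_all add: lyap_def mat_simps scaleR_add_right)

lemmas lyap_simps = linear_add[OF linear_lyap] linear_diff[OF linear_lyap]
  linear_neg[OF linear_lyap] linear_scale[OF linear_lyap]

lemma symm_lyap: "symm X \<Longrightarrow> symm (lyap M X)"
  by (simp add: symm_def lyap_def mat_simps matrix_transpose_mul add.commute)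

text \<open>The right side depends on \<open>X\<close> through \<open>X *v x\<close> alone, so the
  form vanishes at kernel vectors of \<open>X\<close>. Applied to a pencil, this is what makes
  extremal eigenvectors informative.\<close>

lemma lyap_inner:
  assumes "symm X"
  shows "x \<bullet> (lyap M X *v x) = 2 * ((X *v x) \<bullet> (M *v x))"
proof -
  have "x \<bullet> ((transpose M ** X) *v x) = (X *v x) \<bullet> (M *v x)"
    by (simp add: inner_matrix_transpose[of _ "transpose M"] inner_commute
        flip: matrix_vector_mul_assoc del: transpose_matrix_vector)
  moreover have "x \<bullet> ((X ** M) *v x) = (X *v x) \<bullet> (M *v x)"
    using assms by (simp add: symm_inner flip: matrix_vector_mul_assoc)
  ultimately show ?thesis by (simp add: lyap_def mat_simps inner_add_right)
qed

lemma norm_lyap_diff_le: "norm (lyap M X - lyap N X) \<le> 2 * norm (M - N) * norm X"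
proof -
  have "lyap M X - lyap N X = transpose (M - N) ** X + X ** (M - N)"
    by (simp add: lyap_def mat_simps)
  also have "norm \<dots> \<le> norm (transpose (M - N)) * norm X + norm X * norm (M - N)"
    by (intro norm_triangle_mono norm_matrix_mult_le)
  finally show ?thesis by (simp add: norm_transpose mult_ac)
qed

section \<open>Observability and unique solvability of Lyapunov equations\<close>

lemma mpow_Suc_vector: "mpow M (Suc k) *v x = M *v (mpow M k *v x)"
  by (simp add: mpow_def matrix_vector_mul_assoc)

lemma mpow_0_vector: "mpow M 0 *v x = x"
  by (simp add: mpow_def)

text \<open>Such an \<open>x\<close> is orthogonal to all rows of the observability matrix; these
  span the space, so \<open>x\<close> is orthogonal to itself.\<close>

lemma observable_kernel:
  fixes M :: "real^'n^'n"
  assumes obs: "observable M C" and ker: "\<And>k. C *v (mpow M k *v x) = 0"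
  shows "x = 0"
proof -
  let ?S = "\<Union>k<CARD('n). rows (C ** mpow M k)"
  have "span (span ?S) = UNIV"
    using obs unfolding observable_def by (subst dim_eq_full[symmetric]) simp
  then have "x \<in> span ?S" by (simp add: span_span)
  moreover have "orthogonal x y" if mem: "y \<in> ?S" for y
  proof -
    obtain k i where y: "y = row i (C ** mpow M k)" using mem unfolding rows_def by blast
    have "((C ** mpow M k) *v x) $ i = 0"
      using ker[of k] by (simp flip: matrix_vector_mul_assoc)
    then show ?thesis
      by (simp add: y orthogonal_def matrix_vector_mul_component row_def inner_commute
          vec_lambda_eta)
  qed
  ultimately have "orthogonal x x" by (rule orthogonal_to_span)
  then show "x = 0" by (simp add: orthogonal_def)
qed

text \<open>If the largest eigenvalue \<open>\<mu>\<close> of the pencil \<open>X - \<mu> P\<close> were positive, then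
  the kernel of \<open>\<mu> P - X \<ge> 0\<close> would be invariant under \<open>M\<close> and annihilated by \<open>W\<close>.\<close>
lemma lyap_kernel_nonpos:
  assumes P: "pd P" and W: "psd W" "lyap M P = - W"
    and obs: "\<And>x. (\<And>k. W *v (mpow M k *v x) = 0) \<Longrightarrow> x = 0"
    and X: "symm X" "lyap M X = 0"
  shows "psd (- X)"
proof -
  obtain \<mu> x where x: "x \<noteq> 0" and N: "psd (\<mu> *\<^sub>R P - X)" and Nx: "(\<mu> *\<^sub>R P - X) *v x = 0"
    using pencil_max_eigenvalue[OF P X(1)] by blast
  let ?N = "\<mu> *\<^sub>R P - X"
  have LN: "lyap M ?N = - (\<mu> *\<^sub>R W)"
    using W(2) X(2) by (simp add: lyap_simps)
  have "\<mu> \<le> 0"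
  proof (rule ccontr)
    assume \<mu>: "\<not> \<mu> \<le> 0"
    \<comment> \<open>At a kernel vector of \<open>?N\<close> the form of \<open>lyap M ?N\<close>
      vanishes by \<open>lyap_inner\<close>, yet it is \<open>- \<mu>\<close> times the form of
      \<open>W\<close>.\<close>
    have W0: "W *v y = 0" if "?N *v y = 0" for y
    proof -
      have "y \<bullet> (lyap M ?N *v y) = 0"
        using lyap_inner[of ?N y M] N that by (simp add: psd_def)
      then show ?thesis using LN \<mu> psd_kernel[OF W(1)] by (simp add: mat_simps)
    qed
    have inv: "?N *v (M *v y) = 0" if "?N *v y = 0" for y
    proof -
      have "lyap M ?N *v y = transpose M *v (?N *v y) + ?N *v (M *v y)"
        by (simp only: lyap_def mvmult.add_left matrix_vector_mul_assoc)
      then show ?thesis using that LN W0[OF that] by (simp add: mvmult.minus_left mvmult.scaleR_left)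
    qed
    have "?N *v (mpow M k *v x) = 0" for k
    proof (induction k)
      case 0
      show ?case using Nx by (simp add: mpow_0_vector)
    next
      case (Suc k)
      then show ?case using inv by (simp add: mpow_Suc_vector)
    qed
    then show False using x obs W0 by blast
  qed
  have "y \<bullet> (X *v y) \<le> 0" for y
  proof -
    have "y \<bullet> (X *v y) \<le> \<mu> * (y \<bullet> (P *v y))"
      using N by (simp add: psd_def mat_simps inner_diff_right)
    also have "\<dots> \<le> 0"
      using \<open>\<mu> \<le> 0\<close> pd_imp_psd[OF P] by (simp add: psd_def mult_nonpos_nonneg)
    finally show ?thesis .
  qed
  then show ?thesis using X(1) by (simp add: psd_def symm_minus mat_simps)
qed

lemma lyap_injective:
  assumes P: "pd P" and W: "psd W" "lyap M P = - W"
    and obs: "\<And>x. (\<And>k. W *v (mpow M k *v x) = 0) \<Longrightarrow> x = 0"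
    and X: "symm X" "lyap M X = 0"
  shows "X = 0"
proof (rule psd_antisym)
  show "psd (- X)" using lyap_kernel_nonpos[OF assms] .
  have "lyap M (- X) = 0" using X by (simp add: lyap_simps)
  then have "psd (- (- X))"
    using lyap_kernel_nonpos[OF P W obs symm_minus[OF X(1)]] by blast
  then show "psd X" by simp
qed

text \<open>The symmetric matrices form a finite-dimensional space mapped into itself by
  \<open>lyap M\<close>, so injectivity there gives surjectivity.\<close>

lemma lyap_unique_solution:
  fixes M H :: "real^'n^'n"
  assumes inj: "\<And>X. symm X \<Longrightarrow> lyap M X = 0 \<Longrightarrow> X = 0" and H: "symm H"
  shows "\<exists>!X. symm X \<and> lyap M X = H"
proof (rule ex_ex1I)
  let ?S = "{X :: real^'n^'n. symm X}"
  have "inj_on (lyap M) (span ?S)"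
    unfolding linear_inj_on_iff_eq_0[OF linear_lyap subspace_span]
    using inj by (simp add: span_eq_iff[THEN iffD2, OF subspace_symm])
  then have "dim (lyap M ` ?S) = dim ?S"
    by (rule dim_image_eq[OF linear_lyap])
  moreover have "lyap M ` ?S \<subseteq> ?S" by (auto simp: symm_lyap)
  ultimately have "lyap M ` ?S = ?S"
    by (intro subspace_dim_equal linear_subspace_image[OF linear_lyap] subspace_symm) auto
  then show "\<exists>X. symm X \<and> lyap M X = H" using H by (metis (mono_tags, lifting) image_iff mem_Collect_eq)
next
  fix X Y assume "symm X \<and> lyap M X = H" "symm Y \<and> lyap M Y = H"
  then show "X = Y"
    using inj[of "X - Y"] by (simp add: lyap_simps symm_diff)
qed

text \<open>A weakly decaying positive definite \<open>P\<close> forces the solution \<open>Y\<close> of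
  \<open>M\<^sup>T Y + Y M = - I\<close> to be positive definite: at the smallest eigenvalue of the pencil of
  \<open>Y\<close> and \<open>P\<close> the two decay rates can be compared.\<close>
lemma lyap_minus_mat_1_pd:
  assumes P: "pd P" and W: "psd W" "lyap M P = - W"
    and Y: "symm Y" "lyap M Y = - mat 1"
  shows "pd Y"
proof -
  \<comment> \<open>The pencil lemma yields a maximum, so it is applied to \<open>- Y\<close>; then
    \<open>- \<mu>\<close> is the smallest eigenvalue of \<open>Y\<close> relative to
    \<open>P\<close>.\<close>
  obtain \<mu> x where x: "x \<noteq> 0" and N: "psd (\<mu> *\<^sub>R P - - Y)" and Nx: "(\<mu> *\<^sub>R P - - Y) *v x = 0"
    using pencil_max_eigenvalue[OF P symm_minus[OF Y(1)]] by blast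
  have "lyap M (\<mu> *\<^sub>R P - - Y) = - (\<mu> *\<^sub>R W) - mat 1"
    using W(2) Y(2) by (simp add: lyap_simps)
  moreover have "x \<bullet> (lyap M (\<mu> *\<^sub>R P - - Y) *v x) = 0"
    using lyap_inner[of "\<mu> *\<^sub>R P - - Y" x M] N Nx by (simp add: psd_def)
  ultimately have "\<mu> * (x \<bullet> (W *v x)) = - (x \<bullet> x)"
    by (simp add: mat_simps inner_diff_right)
  moreover have "x \<bullet> x > 0" "x \<bullet> (W *v x) \<ge> 0" using x W(1) by (auto simp: psd_def)
  ultimately have \<mu>: "\<mu> < 0"
    using mult_nonneg_nonneg[of \<mu> "x \<bullet> (W *v x)"] by linarith
  have "0 < y \<bullet> (Y *v y)" if "y \<noteq> 0" for y
  proof -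
    have "0 \<le> \<mu> * (y \<bullet> (P *v y)) + y \<bullet> (Y *v y)"
      using N by (simp add: psd_def mat_simps inner_add_right)
    moreover have "\<mu> * (y \<bullet> (P *v y)) < 0"
      using P that \<mu> by (simp add: pd_def mult_neg_pos)
    ultimately show ?thesis by linarith
  qed
  then show ?thesis using Y(1) by (simp add: pd_def)
qed

section \<open>Hurwitz matrices and stability under small perturbations\<close>

lemma cmat_eigenvector_parts:
  fixes M :: "real^'n^'n"
  assumes "cmat M *v v = e *s v"
  defines "a \<equiv> (\<chi> i. Re (v $ i))" and "b \<equiv> (\<chi> i. Im (v $ i))"
  shows "M *v a = Re e *\<^sub>R a - Im e *\<^sub>R b" and "M *v b = Im e *\<^sub>R a + Re e *\<^sub>R b"
proof -
  have eq: "(\<Sum>j\<in>UNIV. complex_of_real (M $ i $ j) * v $ j) = e * v $ i" for i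
    using assms(1) by (simp add: vec_eq_iff matrix_vector_mult_def cmat_def)
  show "M *v a = Re e *\<^sub>R a - Im e *\<^sub>R b"
    using arg_cong[OF eq, of Re] by (simp add: vec_eq_iff matrix_vector_mult_def a_def b_def)
  show "M *v b = Im e *\<^sub>R a + Re e *\<^sub>R b"
    using arg_cong[OF eq, of Im]
    by (simp add: vec_eq_iff matrix_vector_mult_def a_def b_def add.commute)
qed

text \<open>For an eigenvector \<open>a + i b\<close> the decay terms at \<open>a\<close> and
  \<open>b\<close> add up to \<open>Re e\<close> times the \<open>Y\<close>-energy of
  \<open>a\<close> and \<open>b\<close>; the contributions of \<open>Im e\<close> cancel because
  \<open>Y\<close> is symmetric.\<close>

lemma hurwitz_if_lyap_function:
  fixes M :: "real^'n^'n"
  assumes Y: "pd Y" and decay: "\<And>x. x \<noteq> 0 \<Longrightarrow> (Y *v x) \<bullet> (M *v x) < 0"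
  shows "hurwitz M"
  unfolding hurwitz_def
proof clarify
  fix e :: complex and v :: "complex^'n"
  assume v: "v \<noteq> 0" and eig: "cmat M *v v = e *s v"
  define a :: "real^'n" where "a = (\<chi> i. Re (v $ i))"
  define b :: "real^'n" where "b = (\<chi> i. Im (v $ i))"
  have Ma: "M *v a = Re e *\<^sub>R a - Im e *\<^sub>R b" and Mb: "M *v b = Im e *\<^sub>R a + Re e *\<^sub>R b"
    unfolding a_def b_def using cmat_eigenvector_parts[OF eig] by auto
  have ab: "a \<noteq> 0 \<or> b \<noteq> 0"
    using v by (auto simp: a_def b_def vec_eq_iff complex_eq_iff)
  have sym: "(Y *v b) \<bullet> a = (Y *v a) \<bullet> b"
    using Y by (metis inner_commute pd_def symm_inner)
  have "Re e * ((Y *v a) \<bullet> a + (Y *v b) \<bullet> b) = (Y *v a) \<bullet> (M *v a) + (Y *v b) \<bullet> (M *v b)"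
    by (simp add: Ma Mb inner_diff_right inner_add_right sym algebra_simps)
  also have "\<dots> < 0"
    using ab decay[of a] decay[of b] by (cases "a = 0"; cases "b = 0") (auto simp: mat_simps)
  finally have "Re e * ((Y *v a) \<bullet> a + (Y *v b) \<bullet> b) < 0" .
  moreover have "(Y *v a) \<bullet> a + (Y *v b) \<bullet> b \<ge> 0"
    using pd_imp_psd[OF Y] by (auto simp: psd_def inner_commute intro!: add_nonneg_nonneg)
  ultimately show "Re e < 0" by (meson mult_nonneg_nonneg not_le)
qed

text \<open>As \<open>W\<close> is only semidefinite, \<open>P\<close> need not decay strictly; the
  solution \<open>Y\<close> for right-hand side \<open>- mat 1\<close> does, and strict decay
  survives perturbation. Injectivity in finite dimension gives a lower bound \<open>e\<close> for
  \<open>lyap M\<close>, half of which survives as well.\<close>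

lemma lyap_stable_neighbourhood:
  fixes M P W :: "real^'n^'n"
  assumes P: "pd P" and W: "psd W" "lyap M P = - W"
    and obs: "\<And>x. (\<And>k. W *v (mpow M k *v x) = 0) \<Longrightarrow> x = 0"
  obtains \<eta> c :: real where "\<eta> > 0" "c > 0"
    and "\<And>M'. norm (M' - M) < \<eta> \<Longrightarrow> hurwitz M'"
    and "\<And>M' X. norm (M' - M) < \<eta> \<Longrightarrow> symm X \<Longrightarrow> c * norm X \<le> norm (lyap M' X)"
proof -
  have inj: "X = 0" if "symm X" "lyap M X = 0" for X
    using lyap_injective[OF P W obs that] .
  have "symm (- mat 1 :: real^'n^'n)" by (simp add: symm_def transpose_minus)
  then obtain Y where Y: "symm Y" "lyap M Y = - mat 1"
    using lyap_unique_solution[of M "- mat 1", OF inj] by blast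
  have Ypd: "pd Y" by (rule lyap_minus_mat_1_pd[OF P W Y])
  have "\<exists>e>0. \<forall>X\<in>{X. symm X}. norm (lyap M X) \<ge> e * norm X"
    using inj by (intro injective_imp_isometric closed_subspace subspace_symm
        linear_conv_bounded_linear[THEN iffD1] linear_lyap) auto
  then obtain e where e: "e > 0" "\<And>X. symm X \<Longrightarrow> norm (lyap M X) \<ge> e * norm X"
    by auto
  \<comment> \<open>The first entry keeps the change of the operator below \<open>e / 2\<close>; the
    second keeps \<open>norm Y * norm (M' - M)\<close> below the decay rate \<open>1 / 2\<close> of
    \<open>Y\<close>.\<close>
  define \<eta> where "\<eta> = min (e / 4) (1 / (2 * (norm Y + 1)))"
  have \<eta>: "\<eta> > 0" using e by (simp add: \<eta>_def add_nonneg_pos)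
  show thesis
  proof
    show "\<eta> > 0" by fact
    show "e / 2 > 0" using e by simp
  next
    fix M' assume M': "norm (M' - M) < \<eta>"
    show "hurwitz M'"
    proof (rule hurwitz_if_lyap_function[OF Ypd])
      fix x :: "real^'n" assume x: "x \<noteq> 0"
      have "2 * ((Y *v x) \<bullet> (M *v x)) = - (x \<bullet> x)"
        using lyap_inner[OF Y(1), of x M] Y(2) by (simp add: mat_simps)
      then have "(Y *v x) \<bullet> (M' *v x) = - (norm x)\<^sup>2 / 2 + (Y *v x) \<bullet> ((M' - M) *v x)"
        by (simp add: mat_simps inner_diff_right power2_norm_eq_inner)
      also have "(Y *v x) \<bullet> ((M' - M) *v x) \<le> (norm Y * norm x) * (norm (M' - M) * norm x)"
        by (rule order_trans[OF norm_cauchy_schwarz]) (intro mult_mono norm_matrix_vector_mult_le; simp)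
      also have "\<dots> = (norm Y * norm (M' - M)) * (norm x)\<^sup>2"
        by (simp add: power2_eq_square)
      also have "norm Y * norm (M' - M) < 1 / 2"
      proof -
        have "norm Y * norm (M' - M) \<le> norm Y * \<eta>"
          using M' by (intro mult_left_mono) auto
        also have "\<dots> < (norm Y + 1) * \<eta>" using \<eta> by simp
        also have "\<dots> \<le> (norm Y + 1) * (1 / (2 * (norm Y + 1)))"
          by (intro mult_left_mono) (auto simp: \<eta>_def)
        also have "\<dots> = 1 / 2" by (simp add: add_nonneg_pos less_imp_neq[symmetric])
        finally show ?thesis .
      qed
      finally show "(Y *v x) \<bullet> (M' *v x) < 0" using x by simp
    qed
    fix X :: "real^'n^'n" assume X: "symm X"
    have "e * norm X \<le> norm (lyap M X)" by (rule e(2)[OF X])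
    also have "\<dots> \<le> norm (lyap M' X) + norm (lyap M' X - lyap M X)"
      by (metis norm_minus_commute norm_triangle_sub)
    also have "norm (lyap M' X - lyap M X) \<le> 2 * norm (M' - M) * norm X"
      by (rule norm_lyap_diff_le)
    also have "\<dots> \<le> e / 2 * norm X"
      using M' by (intro mult_right_mono) (auto simp: \<eta>_def)
    finally show "e / 2 * norm X \<le> norm (lyap M' X)" by simp
  qed
qed

section \<open>Linear recursive inequalities\<close>

text \<open>The number \<open>c / (1 - \<sigma>) * D\<close> is the fixed point of
  \<open>x \<mapsto> \<sigma> * x + c * D\<close>.\<close>

lemma linear_recursion_bound:
  fixes e d :: "nat \<Rightarrow> real"
  assumes \<sigma>: "0 \<le> \<sigma>" "\<sigma> < 1" and c: "0 \<le> c"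
    and step: "\<And>i. e (Suc i) \<le> \<sigma> * e i + c * d i" and d: "\<And>i. d i \<le> D" and D: "0 \<le> D"
  shows "e i \<le> \<sigma> ^ i * e 0 + c / (1 - \<sigma>) * D"
proof (induction i)
  case 0
  then show ?case using \<sigma> c D by simp
next
  case (Suc i)
  have "e (Suc i) \<le> \<sigma> * e i + c * D"
    using step[of i] mult_left_mono[OF d c, of i] by linarith
  also have "\<dots> \<le> \<sigma> * (\<sigma> ^ i * e 0 + c / (1 - \<sigma>) * D) + c * D"
    using Suc mult_left_mono[OF Suc \<sigma>(1)] by simp
  also have "\<dots> = \<sigma> ^ Suc i * e 0 + c / (1 - \<sigma>) * D"
    using \<sigma> by (simp add: field_simps)
  finally show ?case .
qed

text \<open>Restart the recursion at an index after which the input stays below \<open>D\<close>: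
  the fixed-point term is then small and the initial term decays geometrically.\<close>

lemma linear_recursion_tendsto_0:
  fixes e d :: "nat \<Rightarrow> real"
  assumes \<sigma>: "0 \<le> \<sigma>" "\<sigma> < 1" and c: "0 \<le> c"
    and step: "\<And>i. e (Suc i) \<le> \<sigma> * e i + c * d i" and e: "\<And>i. 0 \<le> e i"
    and d: "d \<longlonglongrightarrow> 0"
  shows "e \<longlonglongrightarrow> 0"
proof (rule LIMSEQ_I)
  fix r :: real assume r: "0 < r"
  \<comment> \<open>Chosen to make the fixed point at most \<open>r / 2\<close>;
    \<open>c + 1\<close> instead of \<open>c\<close> admits \<open>c = 0\<close>.\<close>
  define D where "D = r * (1 - \<sigma>) / (2 * (c + 1))"
  have D: "D > 0" using r \<sigma> c by (simp add: D_def)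
  have "c / (1 - \<sigma>) * D = r / 2 * (c / (c + 1))" using \<sigma> by (simp add: D_def)
  also have "\<dots> \<le> r / 2 * 1" using r c by (intro mult_left_mono) auto
  finally have cD: "c / (1 - \<sigma>) * D \<le> r / 2" by simp
  obtain N where N: "\<And>i. i \<ge> N \<Longrightarrow> norm (d i - 0) < D"
    using LIMSEQ_D[OF d D] by blast
  have bound: "e (i + N) \<le> \<sigma> ^ i * e N + c / (1 - \<sigma>) * D" for i
    using linear_recursion_bound[OF \<sigma> c, of "\<lambda>i. e (i + N)" "\<lambda>i. d (i + N)" D i] step N D
    by (force simp: abs_less_iff less_imp_le)
  have "(\<lambda>i. \<sigma> ^ i * e N) \<longlonglongrightarrow> 0"
    using \<sigma> by (intro tendsto_mult_left_zero LIMSEQ_realpow_zero) auto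
  then obtain N' where N': "\<And>i. i \<ge> N' \<Longrightarrow> norm (\<sigma> ^ i * e N - 0) < r / 2"
    using LIMSEQ_D[of _ _ "r / 2"] r by (metis half_gt_zero)
  have "norm (e i - 0) < r" if "i \<ge> N + N'" for i
  proof -
    have "e i \<le> \<sigma> ^ (i - N) * e N + c / (1 - \<sigma>) * D"
      using bound[of "i - N"] that by simp
    moreover have "\<sigma> ^ (i - N) * e N < r / 2"
      using N'[of "i - N"] that by (simp only: real_norm_def) linarith
    ultimately show ?thesis using cD e[of i] by (simp only: real_norm_def)
  qed
  then show "\<exists>no. \<forall>n\<ge>no. norm (e n - 0) < r" by blast
qed

section \<open>Blocks of the perturbed matrix\<close>

lemma norm_reindex_le:
  fixes v :: "'a::real_normed_vector^'k"
  assumes "inj f"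
  shows "norm (\<chi> a. v $ f a) \<le> norm v"
proof -
  have "(\<Sum>a\<in>UNIV. (norm (v $ f a))\<^sup>2) = (\<Sum>i\<in>range f. (norm (v $ i))\<^sup>2)"
    using sum.reindex[OF assms, of "\<lambda>i. (norm (v $ i))\<^sup>2"] by (simp add: comp_def)
  also have "\<dots> \<le> (\<Sum>i\<in>UNIV. (norm (v $ i))\<^sup>2)"
    by (rule sum_mono2) auto
  finally show ?thesis by (simp add: norm_vec_def L2_set_def)
qed

lemma norm_submatrix_le:
  fixes G :: "real^'k^'l"
  assumes "inj f" and "inj g"
  shows "norm (\<chi> a b. G $ f a $ g b) \<le> norm G"
proof -
  have "norm (\<chi> a b. G $ f a $ g b) \<le> norm (\<chi> a. G $ f a)"
    by (rule norm_le_componentwise_cart) (simp add: norm_reindex_le[OF assms(2)])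
  also have "\<dots> \<le> norm G" by (rule norm_reindex_le[OF assms(1)])
  finally show ?thesis .
qed

lemma norm_blk22_le: "norm (blk22 G) \<le> norm G"
  and norm_blk21_le: "norm (blk21 G) \<le> norm G"
  by (simp_all add: blk22_def blk21_def norm_submatrix_le)

text \<open>The policy update reads these two blocks, so it takes the form treated in
  \<open>policy_improvement_estimate\<close>.\<close>

lemma blk22_Gtil_add: "blk22 (Gtil A B Q R P + D) = R + blk22 D"
  and blk21_Gtil_add: "blk21 (Gtil A B Q R P + D) = transpose B ** P + blk21 D"
  by (simp_all add: blk22_def blk21_def Gtil_def vec_eq_iff)

section \<open>Perturbed policy iteration near the Riccati solution\<close>

lemma matrix_inv_eqs:
  fixes R :: "real^'m^'m"
  assumes "invertible R"
  shows "R ** matrix_inv R = mat 1" and "matrix_inv R ** R = mat 1"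
  using assms unfolding invertible_def matrix_inv_def by (metis (mono_tags, lifting) someI_ex)+

lemma pd_imp_invertible:
  fixes R :: "real^'m^'m"
  assumes "pd R"
  shows "invertible R"
  unfolding invertible_left_inverse matrix_left_invertible_ker
  using assms by (metis inner_zero_right less_irrefl pd_def)

section \<open>The Riccati setting and its optimal gain\<close>

locale lqr =
  fixes A :: "real^'n^'n" and B :: "real^'m^'n" and Q :: "real^'n^'n"
    and R :: "real^'m^'m" and Ps :: "real^'n^'n"
  assumes Q: "psd Q"
    and obs: "observable A (msqrt Q)"
    and R: "pd R"
    and Ps: "pd Ps"
    and ARE: "transpose A ** Ps + Ps ** A
              - Ps ** B ** matrix_inv R ** transpose B ** Ps + Q = 0"
begin

definition gain :: "real^'n^'n \<Rightarrow> real^'n^'m" where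
  "gain P = matrix_inv R ** transpose B ** P"

abbreviation "Ks \<equiv> gain Ps"

lemma R_inv: "R ** matrix_inv R = mat 1" "matrix_inv R ** R = mat 1"
  using matrix_inv_eqs pd_imp_invertible[OF R] by auto

lemma symms: "symm R" "symm Ps" "symm Q"
  using R Ps Q by (auto simp: pd_def psd_def)

lemma transpose_R_inv: "transpose (matrix_inv R) = matrix_inv R"
proof -
  have "transpose (matrix_inv R) ** R = mat 1"
    using R_inv(1) symms(1) by (metis matrix_transpose_mul symm_def transpose_mat)
  then show ?thesis using R_inv(1) by (metis matrix_mul_assoc matrix_mul_lid matrix_mul_rid)
qed

lemma R_gain: "R ** gain P = transpose B ** P"
  by (simp add: gain_def matrix_mul_assoc R_inv)

text \<open>Identifies the quadratic Riccati term with the control cost of a gain, so the equation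
  for \<open>Pplus\<close> is policy evaluation at \<open>gain P\<close>.\<close>

lemma gain_quadratic:
  assumes "symm P"
  shows "transpose (gain P) ** R ** gain P = P ** B ** matrix_inv R ** transpose B ** P"
proof -
  have "transpose (gain P) = P ** B ** matrix_inv R"
    using assms by (simp add: gain_def matrix_transpose_mul transpose_R_inv symm_def matrix_mul_assoc)
  moreover have "transpose (gain P) ** R ** gain P = transpose (gain P) ** (transpose B ** P)"
    by (simp flip: R_gain add: matrix_mul_assoc)
  ultimately show ?thesis by (simp add: matrix_mul_assoc)
qed

text \<open>Completing the square in \<open>K - Ks\<close>.\<close>
lemma lyap_Ps:
  "lyap (A - B ** K) Ps = transpose (K - Ks) ** R ** (K - Ks) - (Q + transpose K ** R ** K)"
proof -
  have BP: "transpose B ** Ps = R ** Ks" by (simp add: R_gain)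
  have PB: "Ps ** B = transpose Ks ** R"
    using arg_cong[OF BP, of transpose] symms by (simp add: matrix_transpose_mul symm_def)
  have are: "transpose A ** Ps + Ps ** A = transpose Ks ** R ** Ks - Q"
    using ARE by (simp add: gain_quadratic symms algebra_simps)
  have "lyap (A - B ** K) Ps
      = (transpose A ** Ps + Ps ** A) - transpose K ** (transpose B ** Ps) - Ps ** B ** K"
    by (simp add: lyap_def mat_simps matrix_transpose_mul matrix_mul_assoc)
  also have "\<dots> = transpose (K - Ks) ** R ** (K - Ks) - (Q + transpose K ** R ** K)"
    unfolding are BP PB by (simp add: mat_simps matrix_mul_assoc)
  finally show ?thesis .
qed

lemma lyap_sol_eq:
  "lyap_sol A B Q R K = (THE X. symm X \<and> lyap (A - B ** K) X = - (Q + transpose K ** R ** K))"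
  unfolding lyap_sol_def lyap_def by (simp only: eq_neg_iff_add_eq_0 add.assoc)

text \<open>The weight splits into two nonnegative forms, so its kernel lies in those of
  \<open>Q\<close> and \<open>Ks\<close>. Where \<open>Ks\<close> vanishes along the orbit, feedback
  is inactive and the orbit is that of \<open>A\<close>, to which observability applies.\<close>

lemma closed_loop_observable:
  assumes ker: "\<And>k. (Q + transpose Ks ** R ** Ks) *v (mpow (A - B ** Ks) k *v x) = 0"
  shows "x = 0"
proof -
  let ?W = "Q + transpose Ks ** R ** Ks"
  have W0: "Q *v y = 0 \<and> Ks *v y = 0" if "?W *v y = 0" for y
  proof -
    have KRK: "y \<bullet> ((transpose Ks ** R ** Ks) *v y) = (Ks *v y) \<bullet> (R *v (Ks *v y))"
      by (simp add: inner_matrix_transpose[of _ "transpose Ks"]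
          flip: matrix_vector_mul_assoc del: transpose_matrix_vector)
    have "y \<bullet> (Q *v y) + (Ks *v y) \<bullet> (R *v (Ks *v y)) = y \<bullet> (?W *v y)"
      by (simp only: KRK mvmult.add_left inner_add_right)
    also have "\<dots> = 0" using that by simp
    finally have "y \<bullet> (Q *v y) + (Ks *v y) \<bullet> (R *v (Ks *v y)) = 0" .
    moreover have "y \<bullet> (Q *v y) \<ge> 0" "(Ks *v y) \<bullet> (R *v (Ks *v y)) \<ge> 0"
      using Q pd_imp_psd[OF R] by (auto simp: psd_def)
    ultimately have "y \<bullet> (Q *v y) = 0" "(Ks *v y) \<bullet> (R *v (Ks *v y)) = 0" by linarith+
    then show ?thesis using psd_kernel[OF Q] R by (metis less_irrefl pd_def)
  qed
  have pow: "mpow (A - B ** Ks) k *v x = mpow A k *v x" for k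
  proof (induction k)
    case 0
    show ?case by (simp add: mpow_0_vector)
  next
    case (Suc k)
    have "Ks *v (mpow A k *v x) = 0" using W0[OF ker[of k]] Suc by simp
    then show ?case
      by (simp add: mpow_Suc_vector Suc mvmult.diff_left flip: matrix_vector_mul_assoc[of B])
  qed
  show ?thesis
  proof (rule observable_kernel[OF obs])
    show "msqrt Q *v (mpow A k *v x) = 0" for k
      using msqrt_kernel[OF Q] W0[OF ker[of k]] by (simp add: pow)
  qed
qed

text \<open>By \<open>lyap_Ps\<close> the error \<open>X - Ps\<close> solves a Lyapunov equation
  whose right-hand side is quadratic in \<open>K - Ks\<close>. The version for arbitrary
  \<open>X\<close> serves claim (a), the one for \<open>lyap_sol\<close> the iteration.\<close>

lemma policy_evaluation_estimate:
  obtains \<kappa> L :: real where "\<kappa> > 0" "L > 0"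
    and "\<And>K. norm (K - Ks) < \<kappa> \<Longrightarrow> hurwitz (A - B ** K)"
    and "\<And>K X. norm (K - Ks) < \<kappa> \<Longrightarrow> symm X \<Longrightarrow>
           lyap (A - B ** K) X = - (Q + transpose K ** R ** K) \<Longrightarrow>
           norm (X - Ps) \<le> L * (norm (K - Ks))\<^sup>2"
    and "\<And>K. norm (K - Ks) < \<kappa> \<Longrightarrow>
           norm (lyap_sol A B Q R K - Ps) \<le> L * (norm (K - Ks))\<^sup>2"
proof -
  let ?W = "Q + transpose Ks ** R ** Ks"
  have "psd ?W" using Q R by (simp add: psd_add psd_congruence pd_imp_psd)
  moreover have "lyap (A - B ** Ks) Ps = - ?W" by (simp add: lyap_Ps mat_simps)
  ultimately obtain \<eta> c where \<eta>: "\<eta> > 0" and c: "c > 0"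
    and hur: "\<And>M'. norm (M' - (A - B ** Ks)) < \<eta> \<Longrightarrow> hurwitz M'"
    and lower: "\<And>M' X. norm (M' - (A - B ** Ks)) < \<eta> \<Longrightarrow> symm X
                  \<Longrightarrow> c * norm X \<le> norm (lyap M' X)"
    using lyap_stable_neighbourhood[OF Ps] closed_loop_observable by metis
  define \<kappa> where "\<kappa> = \<eta> / (norm B + 1)"
  have B1: "norm B + 1 > 0" by (simp add: add_nonneg_pos)
  \<comment> \<open>The \<open>+ 1\<close> makes \<open>L\<close> positive, so that it may later
    stand in a denominator.\<close>
  define L where "L = (norm R + 1) / c"
  have near: "norm (A - B ** K - (A - B ** Ks)) < \<eta>" if "norm (K - Ks) < \<kappa>" for K
  proof -
    have "A - B ** K - (A - B ** Ks) = - (B ** (K - Ks))" by (simp add: mat_simps)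
    then have "norm (A - B ** K - (A - B ** Ks)) \<le> norm B * norm (K - Ks)"
      by (simp add: norm_matrix_mult_le)
    also have "\<dots> \<le> (norm B + 1) * norm (K - Ks)" by (simp add: mult_right_mono)
    also have "\<dots> < \<eta>" using that B1 by (simp add: \<kappa>_def field_simps)
    finally show ?thesis .
  qed
  have est: "norm (X - Ps) \<le> L * (norm (K - Ks))\<^sup>2"
    if K: "norm (K - Ks) < \<kappa>" and X: "symm X" "lyap (A - B ** K) X = - (Q + transpose K ** R ** K)"
    for K X
  proof -
    let ?D = "K - Ks"
    have "lyap (A - B ** K) (X - Ps) = - (transpose ?D ** R ** ?D)"
      by (simp add: lyap_simps X lyap_Ps)
    then have "c * norm (X - Ps) \<le> norm (transpose ?D ** R ** ?D)"
      using lower[OF near[OF K] symm_diff[OF X(1) symms(2)]] by simp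
    also have "\<dots> \<le> norm ?D * norm R * norm ?D"
      using norm_matrix_mult_le[of "transpose ?D" R]
      by (intro order_trans[OF norm_matrix_mult_le] mult_right_mono) (simp_all add: norm_transpose)
    also have "\<dots> \<le> (norm R + 1) * (norm ?D)\<^sup>2"
      by (simp add: power2_eq_square algebra_simps)
    finally show ?thesis using c by (simp add: L_def field_simps)
  qed
  show thesis
  proof
    show "\<kappa> > 0" using \<eta> B1 by (simp add: \<kappa>_def)
    show "L > 0" using c by (simp add: L_def add_nonneg_pos)
    fix K assume K: "norm (K - Ks) < \<kappa>"
    show "hurwitz (A - B ** K)" by (rule hur[OF near[OF K]])
    \<comment> \<open>The lower bound excludes a symmetric kernel, so the description in
      \<open>lyap_sol\<close> denotes an actual solution.\<close>
    have inj: "X = 0" if "symm X" "lyap (A - B ** K) X = 0" for X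
      using lower[OF near[OF K] that(1)] that(2) c by (simp add: mult_le_0_iff)
    have "symm (- (Q + transpose K ** R ** K))"
      by (intro symm_minus symm_add symm_congruence symms)
    then have "\<exists>!X. symm X \<and> lyap (A - B ** K) X = - (Q + transpose K ** R ** K)"
      using inj by (intro lyap_unique_solution)
    from theI'[OF this, folded lyap_sol_eq]
    show "norm (lyap_sol A B Q R K - Ps) \<le> L * (norm (K - Ks))\<^sup>2"
      using est[OF K] by simp
  next
    fix K X
    assume "norm (K - Ks) < \<kappa>" "symm X" "lyap (A - B ** K) X = - (Q + transpose K ** R ** K)"
    then show "norm (X - Ps) \<le> L * (norm (K - Ks))\<^sup>2" by (rule est)
  qed
qed

text \<open>Subtracting \<open>R ** Ks = transpose B ** Ps\<close> from the equation for the new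
  gain \<open>K\<close> leaves \<open>D ** K\<close> as the implicit term; it is split at
  \<open>Ks\<close>, and its part in \<open>K - Ks\<close> is absorbed on the left.\<close>

lemma policy_improvement_estimate:
  obtains r \<beta> \<gamma> :: real where "r > 0" "\<beta> > 0" "\<gamma> > 0"
    and "\<And>D. norm D < r \<Longrightarrow> invertible (R + D)"
    and "\<And>P D E d. norm D \<le> d \<Longrightarrow> norm E \<le> d \<Longrightarrow> d < r \<Longrightarrow>
           norm (matrix_inv (R + D) ** (transpose B ** P + E) - Ks) \<le> \<beta> * norm (P - Ps) + \<gamma> * d"
proof -
  define q where "q = norm (matrix_inv R) + 1"
  have q: "q > 0" by (simp add: q_def add_nonneg_pos)
  \<comment> \<open>The bound \<open>q * d \<le> 1 / 2\<close> serves twice: for invertibility of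
    \<open>R + D\<close> and for the absorption.\<close>
  define r where "r = 1 / (2 * q)"
  have r: "q * d \<le> 1 / 2" if "d < r" for d
    using that q by (simp add: r_def field_simps)
  have Rinv_le: "norm (matrix_inv R ** M) \<le> q * norm M" for M :: "real^'k^'m"
    by (rule order_trans[OF norm_matrix_mult_le]) (simp add: q_def mult_right_mono)
  have inv: "invertible (R + D)" if D: "norm D < r" for D
    unfolding invertible_left_inverse matrix_left_invertible_ker
  proof clarify
    fix x assume "(R + D) *v x = 0"
    then have "R *v x = - (D *v x)" by (simp add: mat_simps eq_neg_iff_add_eq_0)
    then have "x = - ((matrix_inv R ** D) *v x)"
      using R_inv(2) by (metis matrix_vector_mul_assoc matrix_vector_mul_lid mvmult.minus_right)
    then have "norm x = norm ((matrix_inv R ** D) *v x)" by (metis norm_minus_cancel)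
    also have "\<dots> \<le> q * norm D * norm x"
      by (rule order_trans[OF norm_matrix_vector_mult_le]) (simp add: mult_right_mono Rinv_le)
    also have "\<dots> \<le> 1 / 2 * norm x" by (intro mult_right_mono r D) simp
    finally show "x = 0" by simp
  qed
  \<comment> \<open>The factors 2 pay for absorbing half of \<open>norm (K - Ks)\<close>; in
    \<gamma>, the summand 1 accounts for \<open>E\<close> and \<open>norm Ks\<close> for
    \<open>D ** Ks\<close>.\<close>
  define \<beta> where "\<beta> = 2 * q * (norm B + 1)"
  define \<gamma> where "\<gamma> = 2 * q * (1 + norm Ks)"
  show thesis
  proof
    show "r > 0" "\<beta> > 0" "\<gamma> > 0"
      using q by (auto simp: r_def \<beta>_def \<gamma>_def add_nonneg_pos add_pos_nonneg)
    show "invertible (R + D)" if "norm D < r" for D by (rule inv[OF that])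
    fix P :: "real^'n^'n" and D :: "real^'m^'m" and E :: "real^'n^'m" and d :: real
    assume D: "norm D \<le> d" and E: "norm E \<le> d" and d: "d < r"
    define K where "K = matrix_inv (R + D) ** (transpose B ** P + E)"
    have "(R + D) ** K = transpose B ** P + E"
      using matrix_inv_eqs(1)[OF inv] D d by (simp add: K_def matrix_mul_assoc)
    then have "R ** (K - Ks) = transpose B ** (P - Ps) + E - D ** K"
      by (simp add: mat_simps R_gain algebra_simps)
    then have "K - Ks = matrix_inv R ** (transpose B ** (P - Ps) + E - D ** K)"
      using R_inv(2) by (metis matrix_mul_assoc matrix_mul_lid)
    then have "norm (K - Ks) \<le> q * norm (transpose B ** (P - Ps) + E - D ** K)"
      by (metis Rinv_le)
    also have "\<dots> \<le> q * (norm B * norm (P - Ps) + d + d * (norm Ks + norm (K - Ks)))"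
    proof (rule mult_left_mono)
      have "norm K \<le> norm Ks + norm (K - Ks)" by (metis add.commute norm_triangle_sub)
      moreover have "0 \<le> d" using D norm_ge_zero order_trans by blast
      ultimately have "norm (D ** K) \<le> d * (norm Ks + norm (K - Ks))"
        using D by (intro order_trans[OF norm_matrix_mult_le] mult_mono) auto
      moreover have "norm (transpose B ** (P - Ps)) \<le> norm B * norm (P - Ps)"
        by (metis norm_matrix_mult_le norm_transpose)
      ultimately show "norm (transpose B ** (P - Ps) + E - D ** K)
          \<le> norm B * norm (P - Ps) + d + d * (norm Ks + norm (K - Ks))"
        using E norm_triangle_ineq4[of "transpose B ** (P - Ps) + E" "D ** K"]
          norm_triangle_ineq[of "transpose B ** (P - Ps)" E] by linarith
    qed (use q in simp)
    also have "\<dots> = q * norm B * norm (P - Ps) + \<gamma> / 2 * d + (q * d) * norm (K - Ks)"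
      by (simp add: \<gamma>_def algebra_simps)
    also have "(q * d) * norm (K - Ks) \<le> 1 / 2 * norm (K - Ks)"
      by (intro mult_right_mono r d) simp
    also have "q * norm B * norm (P - Ps) \<le> \<beta> / 2 * norm (P - Ps)"
      using q by (simp add: \<beta>_def mult_right_mono)
    finally show "norm (matrix_inv (R + D) ** (transpose B ** P + E) - Ks)
        \<le> \<beta> * norm (P - Ps) + \<gamma> * d"
      by (simp add: K_def)
  qed
qed

text \<open>For gain error \<open>x \<le> \<beta> * e + \<gamma> * d\<close> below the threshold
  \<open>s\<close>, one factor in \<open>L * x^2\<close> is traded for
  \<open>\<sigma> / (L * \<beta>)\<close>, which makes the recursion linear. Claim (a) is the case
  \<open>d = 0\<close>.\<close>

lemma robust_policy_iteration:
  fixes \<sigma> :: real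
  assumes \<sigma>: "0 < \<sigma>" "\<sigma> < 1"
  obtains \<delta>0 \<delta>1 c :: real where "\<delta>0 > 0" "\<delta>1 > 0" "c > 0"
    and "\<And>P Pplus. symm P \<Longrightarrow> norm (P - Ps) < \<delta>0 \<Longrightarrow>
      hurwitz (Acl A B R P) \<and>
      (symm Pplus \<and>
       transpose (Acl A B R P) ** Pplus + Pplus ** Acl A B R P
         = - Q - P ** B ** matrix_inv R ** transpose B ** P
       \<longrightarrow> norm (Pplus - Ps) \<le> \<sigma> * norm (P - Ps))"
    and "\<And>P0 dG. dG 0 = 0 \<Longrightarrow> norm (P0 - Ps) < \<delta>0 \<Longrightarrow>
      bdd_above (range (\<lambda>i. norm (dG i))) \<Longrightarrow> (SUP i. norm (dG i)) < \<delta>1 \<Longrightarrow>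
      (\<forall>i\<ge>1. invertible (blk22 (Ghat A B Q R P0 dG i)) \<and> stabilizing A B (Khat A B Q R P0 dG i))
      \<and> (\<forall>i. norm (Ptil A B Q R P0 dG i - Ps)
             \<le> \<sigma> ^ i * norm (P0 - Ps) + c / (1 - \<sigma>) * (SUP j. norm (dG j)))
      \<and> ((\<lambda>i. norm (dG i)) \<longlonglongrightarrow> 0
           \<longrightarrow> (\<lambda>i. norm (Ptil A B Q R P0 dG i - Ps)) \<longlonglongrightarrow> 0)"
proof -
  obtain \<kappa> L where \<kappa>: "\<kappa> > 0" and L: "L > 0"
    and hur: "\<And>K. norm (K - Ks) < \<kappa> \<Longrightarrow> hurwitz (A - B ** K)"
    and eval: "\<And>K X. norm (K - Ks) < \<kappa> \<Longrightarrow> symm X \<Longrightarrow>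
           lyap (A - B ** K) X = - (Q + transpose K ** R ** K) \<Longrightarrow>
           norm (X - Ps) \<le> L * (norm (K - Ks))\<^sup>2"
    and eval_sol: "\<And>K. norm (K - Ks) < \<kappa> \<Longrightarrow>
           norm (lyap_sol A B Q R K - Ps) \<le> L * (norm (K - Ks))\<^sup>2"
    using policy_evaluation_estimate by blast
  obtain r \<beta> \<gamma> where r: "r > 0" and \<beta>: "\<beta> > 0" and \<gamma>: "\<gamma> > 0"
    and inv: "\<And>D. norm D < r \<Longrightarrow> invertible (R + D)"
    and improve: "\<And>P D E d. norm D \<le> d \<Longrightarrow> norm E \<le> d \<Longrightarrow> d < r \<Longrightarrow>
       norm (matrix_inv (R + D) ** (transpose B ** P + E) - Ks) \<le> \<beta> * norm (P - Ps) + \<gamma> * d"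
    using policy_improvement_estimate by blast
  \<comment> \<open>The cap \<open>s\<close> on the gain error ensures valid evaluation and
    contraction; errors in \<open>P\<close> and perturbations each get half of it. The last entry of
    \<open>\<delta>1\<close> gives
    \<open>\<sigma> * \<delta>0 + c * \<delta>1 \<le> \<delta>0\<close>, so the ball is
    invariant.\<close>
  define s where "s = min \<kappa> (\<sigma> / (L * \<beta>))"
  define \<delta>0 where "\<delta>0 = s / (2 * \<beta>)"
  define c where "c = \<sigma> * \<gamma> / \<beta>"
  define \<delta>1 where "\<delta>1 = min r (min (s / (2 * \<gamma>)) ((1 - \<sigma>) * \<delta>0 / c))"
  have s: "s > 0" using \<kappa> \<sigma> L \<beta> by (simp add: s_def)
  have \<delta>0: "\<delta>0 > 0" using s \<beta> by (simp add: \<delta>0_def)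
  have c: "c > 0" using \<sigma> \<gamma> \<beta> by (simp add: c_def)
  have \<delta>1: "\<delta>1 > 0" using r s \<gamma> \<sigma> \<delta>0 c by (simp add: \<delta>1_def)
  have contraction: "x < \<kappa> \<and> L * x\<^sup>2 \<le> \<sigma> * e + c * d"
    if x: "0 \<le> x" "x \<le> \<beta> * e + \<gamma> * d" and e: "e < \<delta>0" and d: "d < \<delta>1" for x e d
  proof -
    have "\<beta> * e < s / 2" using e \<beta> by (simp add: \<delta>0_def field_simps)
    moreover have "\<gamma> * d < s / 2" using d \<gamma> by (simp add: \<delta>1_def field_simps)
    ultimately have xs: "x < s" using x by linarith
    have "L * x\<^sup>2 \<le> L * s * x"
      using xs x L by (simp add: power2_eq_square mult_right_mono)
    also have "\<dots> \<le> \<sigma> / \<beta> * x"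
    proof (rule mult_right_mono[OF _ x(1)])
      have "L * s \<le> L * (\<sigma> / (L * \<beta>))" using L by (intro mult_left_mono) (auto simp: s_def)
      then show "L * s \<le> \<sigma> / \<beta>" using L by simp
    qed
    also have "\<dots> \<le> \<sigma> / \<beta> * (\<beta> * e + \<gamma> * d)"
      using x \<sigma> \<beta> by (intro mult_left_mono) auto
    also have "\<dots> = \<sigma> * e + c * d"
      using \<beta> by (simp add: c_def field_simps)
    finally show ?thesis using xs by (simp add: s_def)
  qed
  show thesis
  proof (rule that[OF \<delta>0 \<delta>1 c], goal_cases)
    case (1 P Pplus)
    note P = 1
    have Acl: "Acl A B R P = A - B ** gain P"
      by (simp add: Acl_def gain_def matrix_mul_assoc)
    have "norm (gain P - Ks) \<le> \<beta> * norm (P - Ps) + \<gamma> * 0"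
      using improve[of 0 0 0 P] r by (simp add: gain_def matrix_mul_assoc)
    from contraction[OF norm_ge_zero this P(2) \<delta>1]
    have K: "norm (gain P - Ks) < \<kappa>" "L * (norm (gain P - Ks))\<^sup>2 \<le> \<sigma> * norm (P - Ps)"
      by auto
    have "norm (Pplus - Ps) \<le> \<sigma> * norm (P - Ps)"
      if "symm Pplus" "transpose (Acl A B R P) ** Pplus + Pplus ** Acl A B R P
               = - Q - P ** B ** matrix_inv R ** transpose B ** P"
    proof -
      have "norm (Pplus - Ps) \<le> L * (norm (gain P - Ks))\<^sup>2"
        using that by (intro eval[OF K(1)]) (simp_all add: Acl lyap_def gain_quadratic[OF P(1)])
      then show ?thesis using K(2) by linarith
    qed
    then show ?case using hur[OF K(1)] by (simp add: Acl)
  next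
    case (2 P0 dG)
    note dG0 = 2(1) and P0 = 2(2) and bdd = 2(3) and sup = 2(4)
    define e where "e i = norm (Ptil A B Q R P0 dG i - Ps)" for i
    define K where "K = Khat A B Q R P0 dG"
    have d_le: "norm (dG i) \<le> (SUP i. norm (dG i))" for i
      by (rule cSUP_upper[OF _ bdd]) simp
    have d: "norm (dG i) < \<delta>1" for i using d_le[of i] sup by linarith
    have d22: "norm (blk22 (dG i)) < r" for i
      using norm_blk22_le[of "dG i"] d[of i] by (simp add: \<delta>1_def)
    \<comment> \<open>Since \<open>dG 0 = 0\<close>, the initial gain obeys the same formula as all
      later ones, and the recursion can start at index 0 from \<open>P0\<close>.\<close>
    have K_Suc: "K (Suc i) = matrix_inv (R + blk22 (dG i)) **
        (transpose B ** Ptil A B Q R P0 dG i + blk21 (dG i))" for i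
    proof (cases i)
      case 0
      have "blk22 (dG 0) = 0" "blk21 (dG 0) = 0"
        by (simp_all add: dG0 blk22_def blk21_def vec_eq_iff)
      then show ?thesis by (simp add: K_def 0 Ptil_def matrix_mul_assoc)
    next
      case (Suc j)
      then show ?thesis by (simp add: K_def Let_def blk22_Gtil_add blk21_Gtil_add Ptil_def)
    qed
    have step: "norm (K (Suc i) - Ks) < \<kappa> \<and> e (Suc i) \<le> \<sigma> * e i + c * norm (dG i)"
      if "e i < \<delta>0" for i
    proof -
      have "norm (dG i) < r" using d[of i] by (simp add: \<delta>1_def)
      then have "norm (K (Suc i) - Ks) \<le> \<beta> * e i + \<gamma> * norm (dG i)"
        unfolding K_Suc e_def by (intro improve norm_blk22_le norm_blk21_le)
      from contraction[OF norm_ge_zero this that d]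
      have *: "norm (K (Suc i) - Ks) < \<kappa>"
        "L * (norm (K (Suc i) - Ks))\<^sup>2 \<le> \<sigma> * e i + c * norm (dG i)" by auto
      have "e (Suc i) = norm (lyap_sol A B Q R (K (Suc i)) - Ps)"
        by (simp add: e_def Ptil_def K_def)
      then show ?thesis using eval_sol[OF *(1)] * by linarith
    qed
    \<comment> \<open>Invariance of the ball makes the local estimate \<open>step\<close> available
      at every index.\<close>
    have e: "e i < \<delta>0" for i
    proof (induction i)
      case 0
      show ?case using P0 by (simp add: e_def Ptil_def)
    next
      case (Suc i)
      have "c * norm (dG i) < (1 - \<sigma>) * \<delta>0"
        using d[of i] c by (simp add: \<delta>1_def field_simps)
      moreover have "\<sigma> * e i \<le> \<sigma> * \<delta>0" using Suc \<sigma> by simp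
      ultimately show ?case using step[OF Suc] by (simp add: algebra_simps)
    qed
    note rec = step[OF e, THEN conjunct2]
    have D0: "0 \<le> (SUP i. norm (dG i))" using d_le[of 0] norm_ge_zero order_trans by blast
    have e0: "e 0 = norm (P0 - Ps)" by (simp add: e_def Ptil_def)
    have "e i \<le> \<sigma> ^ i * norm (P0 - Ps) + c / (1 - \<sigma>) * (SUP j. norm (dG j))" for i
      using linear_recursion_bound[of \<sigma> c e, OF _ _ _ rec d_le D0] \<sigma> c by (simp add: e0)
    moreover have "e \<longlonglongrightarrow> 0" if "(\<lambda>i. norm (dG i)) \<longlonglongrightarrow> 0"
      using linear_recursion_tendsto_0[of \<sigma> c e, OF _ _ _ rec _ that] \<sigma> c by (simp add: e_def)
    moreover have "invertible (blk22 (Ghat A B Q R P0 dG i))" for i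
      using inv[OF d22[of i]] by (simp add: Ghat_def blk22_Gtil_add)
    moreover have "stabilizing A B (K i)" if i: "i \<ge> 1" for i
    proof -
      obtain j where "i = Suc j" using i by (cases i) auto
      then show ?thesis using hur step[OF e[of j]] by (simp add: stabilizing_def)
    qed
    ultimately show ?case unfolding e_def[abs_def] K_def by blast
  qed
qed

end

theorem theorem2:
  fixes A :: "real^'n^'n" and B :: "real^'m^'n" and Q :: "real^'n^'n"
    and R :: "real^'m^'m" and Pstar :: "real^'n^'n"
  assumes ctrl: "controllable A B"
    and Qpsd: "psd Q"
    and obs: "observable A (msqrt Q)"
    and Rpd: "pd R"
    and Pstar_pd: "pd Pstar"
    and ARE: "transpose A ** Pstar + Pstar ** A
              - Pstar ** B ** matrix_inv R ** transpose B ** Pstar + Q = 0"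
  shows "\<forall>\<sigma>::real. 0 < \<sigma> \<and> \<sigma> < 1 \<longrightarrow>
     (\<exists>\<delta>0>0.
        (\<forall>P Pplus. symm P \<and> norm (P - Pstar) < \<delta>0 \<longrightarrow>
            hurwitz (Acl A B R P) \<and>
            (symm Pplus \<and>
             transpose (Acl A B R P) ** Pplus + Pplus ** Acl A B R P
               = - Q - P ** B ** matrix_inv R ** transpose B ** P
             \<longrightarrow> norm (Pplus - Pstar) \<le> \<sigma> * norm (P - Pstar)))
      \<and> (\<exists>\<delta>1>0. \<exists>c3>0. \<forall>P0 dG.
            symm P0 \<and> dG 0 = 0 \<and> (\<forall>i. symm (dG i))
            \<and> norm (P0 - Pstar) < \<delta>0
            \<and> bdd_above (range (\<lambda>i. norm (dG i)))
            \<and> (SUP i. norm (dG i)) < \<delta>1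
            \<longrightarrow>
              (\<forall>i\<ge>1. invertible (blk22 (Ghat A B Q R P0 dG i))
                      \<and> stabilizing A B (Khat A B Q R P0 dG i))
            \<and> (\<forall>i. norm (Ptil A B Q R P0 dG i - Pstar)
                   \<le> \<sigma> ^ i * norm (P0 - Pstar) + c3 / (1 - \<sigma>) * (SUP j. norm (dG j)))
            \<and> ((\<lambda>i. norm (dG i)) \<longlonglongrightarrow> 0
                 \<longrightarrow> (\<lambda>i. norm (Ptil A B Q R P0 dG i - Pstar)) \<longlonglongrightarrow> 0)))"
proof (intro allI impI, elim conjE, goal_cases)
  case \<sigma>: (1 \<sigma>)
  interpret lqr A B Q R Pstar
    using Qpsd obs Rpd Pstar_pd ARE by unfold_locales
  show ?case
  proof (rule robust_policy_iteration[OF \<sigma>], goal_cases)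
    \<comment> \<open>The constants are obtained before \<open>P0\<close> and \<open>dG\<close> are
      introduced, as the order of the quantifiers demands.\<close>
    case robust: (1 \<delta>0 \<delta>1 c)
    show ?case
      by (rule exI[of _ \<delta>0], rule conjI[OF robust(1)], rule conjI, use robust(4) in blast,
          rule exI[of _ \<delta>1], rule conjI[OF robust(2)], rule exI[of _ c], rule conjI[OF robust(3)],
          intro allI impI, elim conjE, rule robust(5))
  qed
qed

end
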